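(* Let $\alpha$ be a real number such that $\alpha/\pi$ is irrational and $\cos\alpha$ is transcendental. For $n \geq 1$ let $F_n := \mathbb{Q}(\cos(\alpha/2^n)) \subseteq \mathbb{R}$, so that $F_1 \subseteq F_2 \subseteq \cdots$, and let $F := \bigcup_{n\ge 1} F_n$. Let $E := F(i\sin\alpha) \subseteq \mathbb{C}$, a quadratic extension of $F$. Then: (1) $F$ is rootless and rootless modtor; (2) $E$ is not rootless and not rootless modtor; (3) $F$ does not have good heredity. In particular, a finite extension of a rootless (resp. rootless modtor) field need not be rootless (resp. rootless modtor).
   Context: Let $F$ be a field with algebraic closure $F^{alg}$. A polynomial $P \in F[x]$ is hereditarily irreducible over $F$ if for every integer $n\ge 1$ the polynomial $P(x^n)$ is irreducible over $F$. A polynomial $P\in F[x]$ has good heredity (over $F$) if for some integer $n \geq 1$ the polynomial $P(x^n)$ factors (up to a nonzero constant) as a product of polynomials in $F[x]$ that are hereditarily irreducible over $F$. The field $F$ has good heredity if every polynomial $P \in F[x]$, none of whose roots in $F^{alg}$ is zero or a root of unity, has good heredity over $F$. An element $a \in F$ that is not a root of unity is rootless (in $F$) if for all but finitely many integers $n\ge 1$ the equation $x^n = a$ has no solution in $F$. An element $a\in F$ that is not a root of unity is rootless modtor (in $F$) if for all but finitely many integers $n\ge 1$, for every root of unity $\zeta \in F$ the equation $x^n=\zeta a$ has no solution in $F$. The field $F$ is rootless (resp. rootless modtor) if every nonzero $f \in F$ that is not a root of unity is rootless (resp. rootless modtor) in $F$. *)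

theory Defs
  imports
    Complex_Main
    "HOL-Algebra.Algebraic_Closure_Type"
    "HOL-Algebra.Generated_Fields"
begin

text \<open>
  All fields are subfields, in the sense of HOL-Algebra, of an ambient type-class field regarded
  as a ring structure. Polynomials over such a subfield \<open>K\<close> are polynomials over the ambient type
  whose coefficients lie in \<open>K\<close>.
\<close>

abbreviation is_field :: "'a::field set \<Rightarrow> bool" where
  "is_field K \<equiv> subfield K (ring_of_type_algebra :: 'a ring)"

definition field_adjoin :: "'a::field set \<Rightarrow> 'a \<Rightarrow> 'a set" where
  "field_adjoin K a = generate_field (ring_of_type_algebra :: 'a ring) (insert a K)"

definition extension_degree :: "'a::field set \<Rightarrow> 'a set \<Rightarrow> nat \<Rightarrow> bool" where
  "extension_degree K L d \<longleftrightarrow> is_field K \<and> is_field L \<and> K \<subseteq> L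
     \<and> ring.dimension (ring_of_type_algebra :: 'a ring) d K L"

definition finite_extension :: "'a::field set \<Rightarrow> 'a set \<Rightarrow> bool" where
  "finite_extension K L \<longleftrightarrow> (\<exists>d. extension_degree K L d)"

definition root_of_unity :: "'a::field \<Rightarrow> bool" where
  "root_of_unity z \<longleftrightarrow> (\<exists>m::nat. m \<ge> 1 \<and> z ^ m = 1)"


section \<open>Good heredity\<close>

definition poly_ring_over :: "'a::field set \<Rightarrow> 'a poly ring" where
  "poly_ring_over K =
     (ring_of_type_algebra :: 'a poly ring)\<lparr>carrier := {p. \<forall>i. poly.coeff p i \<in> K}\<rparr>"

definition irreducible_over :: "'a::field set \<Rightarrow> 'a poly \<Rightarrow> bool" where
  "irreducible_over K p \<longleftrightarrow>
     p \<in> carrier (poly_ring_over K) \<and> ring_irreducible\<^bsub>poly_ring_over K\<^esub> p"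

definition subst_power :: "'a::field poly \<Rightarrow> nat \<Rightarrow> 'a poly" where
  "subst_power p n = pcompose p (Polynomial.monom 1 n)"

definition hereditarily_irreducible :: "'a::field set \<Rightarrow> 'a poly \<Rightarrow> bool" where
  "hereditarily_irreducible K p \<longleftrightarrow> p \<in> carrier (poly_ring_over K)
     \<and> (\<forall>n\<ge>1. irreducible_over K (subst_power p n))"

definition good_heredity_poly :: "'a::field set \<Rightarrow> 'a poly \<Rightarrow> bool" where
  "good_heredity_poly K p \<longleftrightarrow> p \<in> carrier (poly_ring_over K)
     \<and> (\<exists>n\<ge>1. \<exists>c\<in>K - {0}. \<exists>qs. (\<forall>q\<in>set qs. hereditarily_irreducible K q)
          \<and> subst_power p n = Polynomial.smult c (prod_list qs))"

text \<open>
  As the ambient field is algebraically closed, the elements algebraic over \<open>K\<close> form an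
  algebraic closure of \<open>K\<close>.
\<close>

definition alg_closure_of :: "'a::alg_closed_field set \<Rightarrow> 'a set" where
  "alg_closure_of K = {z. \<exists>p\<in>carrier (poly_ring_over K). p \<noteq> 0 \<and> poly p z = 0}"

definition good_heredity_field :: "'a::alg_closed_field set \<Rightarrow> bool" where
  "good_heredity_field K \<longleftrightarrow>
     (\<forall>p\<in>carrier (poly_ring_over K).
        (\<forall>z\<in>alg_closure_of K. poly p z = 0 \<longrightarrow> z \<noteq> 0 \<and> \<not> root_of_unity z)
          \<longrightarrow> good_heredity_poly K p)"


section \<open>Rootlessness\<close>

definition rootless_elem :: "'a::field set \<Rightarrow> 'a \<Rightarrow> bool" where
  "rootless_elem K a \<longleftrightarrow> a \<in> K \<and> \<not> root_of_unity a
     \<and> finite {n::nat. n \<ge> 1 \<and> (\<exists>x\<in>K. x ^ n = a)}"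

definition rootless_modtor_elem :: "'a::field set \<Rightarrow> 'a \<Rightarrow> bool" where
  "rootless_modtor_elem K a \<longleftrightarrow> a \<in> K \<and> \<not> root_of_unity a
     \<and> finite {n::nat. n \<ge> 1 \<and> (\<exists>\<zeta>\<in>K. root_of_unity \<zeta> \<and> (\<exists>x\<in>K. x ^ n = \<zeta> * a))}"

definition rootless_field :: "'a::field set \<Rightarrow> bool" where
  "rootless_field K \<longleftrightarrow> (\<forall>f\<in>K. f \<noteq> 0 \<and> \<not> root_of_unity f \<longrightarrow> rootless_elem K f)"

definition rootless_modtor_field :: "'a::field set \<Rightarrow> bool" where
  "rootless_modtor_field K \<longleftrightarrow>
     (\<forall>f\<in>K. f \<noteq> 0 \<and> \<not> root_of_unity f \<longrightarrow> rootless_modtor_elem K f)"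


section \<open>The fields generated by cosines\<close>

definition cos_field :: "real \<Rightarrow> nat \<Rightarrow> complex set" where
  "cos_field \<alpha> n = field_adjoin \<rat> (complex_of_real (cos (\<alpha> / 2 ^ n)))"

definition cos_tower :: "real \<Rightarrow> complex set" where
  "cos_tower \<alpha> = (\<Union>n\<in>{1..}. cos_field \<alpha> n)"

definition cos_tower_ext :: "real \<Rightarrow> complex set" where
  "cos_tower_ext \<alpha> = field_adjoin (cos_tower \<alpha>) (\<i> * complex_of_real (sin \<alpha>))"

end

theory Submission
  imports Defs "HOL-Analysis.Continuum_Not_Denumerable"
begin

text \<open>
  Write \<open>c\<^sub>m = cos (\<alpha> / 2\<^sup>m)\<close>. All \<open>c\<^sub>m\<close> are transcendental, so \<open>\<rat>(c\<^sub>m)\<close> is a rational function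
  field, and the inclusion \<open>\<rat>(c\<^sub>m) \<subseteq> \<rat>(c\<^sub>m\<^sub>+\<^sub>1)\<close> is the substitution of \<open>2 y\<^sup>2 - 1\<close> for the variable.

  Why \<open>F\<close> is rootless (\<open>finite_root_exponents\<close>): the substitution \<open>y \<mapsto> 2 y\<^sup>2 - 1\<close> ramifies, as a map of
  the complex plane, only at \<open>0\<close>, which lies over \<open>-1\<close>. Over any point with nonnegative real part one can
  therefore choose an infinite chain of unramified preimages, by always taking the square root with
  nonnegative real part. Hence if a nonconstant \<open>f = p(c\<^sub>m) / q(c\<^sub>m)\<close> has order \<open>e \<noteq> 0\<close> at such a point
  (a root or pole can be moved to one by a single step up the tower), then \<open>f\<close> still has order \<open>e\<close> at some
  point in every higher level, so \<open>f = x\<^sup>n\<close> forces \<open>n\<close> to divide \<open>e\<close>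
  (\<open>exponent_le_order_difference\<close>). If \<open>f\<close> is constant, that is, rational, so are its roots in
  \<open>F\<close>, and only \<open>0\<close> and \<open>\<plusminus>1\<close> are \<open>n\<close>-th powers of rationals for infinitely many \<open>n\<close>. As \<open>F\<close> is
  real, its roots of unity are \<open>\<plusminus>1\<close>, which gives the version modulo torsion.

  The field \<open>E\<close> contains \<open>cis (\<alpha> / 2\<^sup>m)\<close> for all \<open>m\<close>, by the half-angle identity for the sine. Thus
  \<open>cis \<alpha>\<close>, which is not a root of unity, has \<open>2\<^sup>m\<close>-th roots in \<open>E\<close> for all \<open>m\<close>.

  The polynomial \<open>x\<^sup>2 - 2 cos \<alpha> x + 1\<close> with roots \<open>cis (\<plusminus>\<alpha>)\<close> does not have good heredity: any factor \<open>q\<close>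
  of \<open>x\<^sup>2\<^sup>n - 2 cos \<alpha> x\<^sup>n + 1\<close> that vanishes at \<open>cis (\<alpha> / n)\<close> yields \<open>q(x\<^sup>N)\<close> with \<open>N = 2\<^sup>k\<close>, which vanishes at
  \<open>w = cis (\<alpha> / (n N))\<close>. But \<open>w\<close> has degree at most \<open>2 n\<close> over \<open>F\<close>, for any \<open>k\<close>, since
  \<open>w\<^sup>n = cis (\<alpha> / 2\<^sup>k)\<close> is quadratic over \<open>F\<close>. So \<open>q(x\<^sup>N)\<close> is reducible once \<open>N > 2 n\<close>
  (\<open>irreducible_over_degree_le\<close>).

  That such an \<open>\<alpha>\<close> exists, which the two final existential claims need, follows by counting
  (\<open>exists_transcendental_cosine\<close>).
\<close>

section \<open>Subfields and adjunction of one element\<close>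

lemma type_ring_simps [simp]:
  "carrier (ring_of_type_algebra :: 'a::field ring) = UNIV"
  "x \<otimes>\<^bsub>(ring_of_type_algebra :: 'a ring)\<^esub> y = x * y"
  "x \<oplus>\<^bsub>(ring_of_type_algebra :: 'a ring)\<^esub> y = x + y"
  "\<one>\<^bsub>(ring_of_type_algebra :: 'a ring)\<^esub> = 1"
  "\<zero>\<^bsub>(ring_of_type_algebra :: 'a ring)\<^esub> = 0"
  by (simp_all add: ring_of_type_algebra_def)

lemma type_field: "field (ring_of_type_algebra :: 'a::field ring)"
  by (rule field_from_type_algebra)

lemma type_ring: "ring (ring_of_type_algebra :: 'a::field ring)"
  by (rule ring_from_type_algebra)

lemma type_ring_a_inv [simp]: "\<ominus>\<^bsub>(ring_of_type_algebra :: 'a::field ring)\<^esub> x = - x"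
  by (rule abelian_group.minus_equality[OF ring.is_abelian_group[OF type_ring]]) auto

lemma type_ring_m_inv [simp]:
  "x \<noteq> 0 \<Longrightarrow> inv\<^bsub>(ring_of_type_algebra :: 'a::field ring)\<^esub> x = inverse x"
  by (rule comm_monoid.comm_inv_char[OF cring.axioms(2)[OF cring_from_type_algebra]]) auto

lemma is_fieldI:
  fixes K :: "'a::field set"
  assumes "1 \<in> K" "\<And>x. x \<in> K \<Longrightarrow> - x \<in> K" "\<And>x. x \<in> K \<Longrightarrow> x \<noteq> 0 \<Longrightarrow> inverse x \<in> K"
    and "\<And>x y. x \<in> K \<Longrightarrow> y \<in> K \<Longrightarrow> x + y \<in> K" "\<And>x y. x \<in> K \<Longrightarrow> y \<in> K \<Longrightarrow> x * y \<in> K"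
  shows "is_field K"
  by (rule field.subfieldI'[OF type_field], rule ring.subringI[OF type_ring]) (use assms in auto)

lemma is_fieldD:
  fixes K :: "'a::field set"
  assumes "is_field K"
  shows "1 \<in> K" "0 \<in> K" "x \<in> K \<Longrightarrow> - x \<in> K" "x \<in> K \<Longrightarrow> inverse x \<in> K"
    "x \<in> K \<Longrightarrow> y \<in> K \<Longrightarrow> x + y \<in> K" "x \<in> K \<Longrightarrow> y \<in> K \<Longrightarrow> x * y \<in> K"
    "x \<in> K \<Longrightarrow> y \<in> K \<Longrightarrow> x - y \<in> K" "x \<in> K \<Longrightarrow> y \<in> K \<Longrightarrow> x / y \<in> K"
proof -
  note r = subfieldE(1)[OF assms]
  show 1: "1 \<in> K" "0 \<in> K" 
    using subringE(2,3)[OF r] by simp_all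
  show neg: "x \<in> K \<Longrightarrow> - x \<in> K" for x using subringE(5)[OF r, of x] by simp
  show inv: "x \<in> K \<Longrightarrow> inverse x \<in> K" for x
    using ring.subfield_m_inv(1)[OF type_ring assms, of x] 1 by (cases "x = 0") auto
  show add: "x \<in> K \<Longrightarrow> y \<in> K \<Longrightarrow> x + y \<in> K" for x y using subringE(7)[OF r, of x y] by simp
  show mul: "x \<in> K \<Longrightarrow> y \<in> K \<Longrightarrow> x * y \<in> K" for x y using subringE(6)[OF r, of x y] by simp
  show "x \<in> K \<Longrightarrow> y \<in> K \<Longrightarrow> x - y \<in> K" using add[of x "-y"] neg by simp
  show "x \<in> K \<Longrightarrow> y \<in> K \<Longrightarrow> x / y \<in> K" using mul[of x "inverse y"] inv by (simp add: divide_inverse)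
qed

lemma is_field_power: "is_field K \<Longrightarrow> x \<in> K \<Longrightarrow> x ^ n \<in> K"
  by (induction n) (auto intro: is_fieldD)

lemma is_field_Rats: "is_field (\<rat> :: 'a::field_char_0 set)"
  by (rule is_fieldI) auto

lemma Rats_subset_field: "is_field K \<Longrightarrow> (\<rat> :: 'a::field_char_0 set) \<subseteq> K"
proof
  fix x :: 'a assume K: "is_field K" and "x \<in> \<rat>"
  then obtain a b where ab: "x = of_int a / of_int b"
    by (auto elim: Rats_cases' )
  have nat: "of_nat n \<in> K" for n by (induction n) (auto intro: is_fieldD[OF K])
  have "of_int z \<in> K" for z by (cases z) (auto intro: is_fieldD[OF K] nat simp del: of_nat_Suc)
  then show "x \<in> K" unfolding ab by (intro is_fieldD[OF K])
qed

lemma field_adjoin_is_field: "is_field (field_adjoin K a)"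
  unfolding field_adjoin_def by (rule field.generate_field_is_subfield[OF type_field]) simp

lemma field_adjoin_base: "x \<in> K \<Longrightarrow> x \<in> field_adjoin K a"
  unfolding field_adjoin_def by (rule generate_field.incl) simp

lemma field_adjoin_elem: "a \<in> field_adjoin K a"
  unfolding field_adjoin_def by (rule generate_field.incl) simp

lemma field_adjoin_least:
  assumes "is_field L" "K \<subseteq> L" "a \<in> L"
  shows "field_adjoin K a \<subseteq> L"
  unfolding field_adjoin_def
  using field.generate_field_min_subfield1[OF type_field _ assms(1)] assms(2,3) by simp

abbreviation polys_over :: "'a::field set \<Rightarrow> 'a poly set" where
  "polys_over K \<equiv> {p. \<forall>i. poly.coeff p i \<in> K}"

lemma polys_over_closed:
  assumes K: "is_field K"
  shows "0 \<in> polys_over K" "1 \<in> polys_over K"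
    "p \<in> polys_over K \<Longrightarrow> q \<in> polys_over K \<Longrightarrow> p + q \<in> polys_over K"
    "p \<in> polys_over K \<Longrightarrow> q \<in> polys_over K \<Longrightarrow> p - q \<in> polys_over K"
    "p \<in> polys_over K \<Longrightarrow> - p \<in> polys_over K"
    "p \<in> polys_over K \<Longrightarrow> q \<in> polys_over K \<Longrightarrow> p * q \<in> polys_over K"
    "c \<in> K \<Longrightarrow> p \<in> polys_over K \<Longrightarrow> Polynomial.smult c p \<in> polys_over K"
    "c \<in> K \<Longrightarrow> p \<in> polys_over K \<Longrightarrow> pCons c p \<in> polys_over K"
    "c \<in> K \<Longrightarrow> Polynomial.monom c n \<in> polys_over K"
proof -
  have sum: "sum f A \<in> K" if "\<And>i. i \<in> A \<Longrightarrow> f i \<in> K" for f :: "nat \<Rightarrow> 'a" and A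
    using that by (induction A rule: infinite_finite_induct) (auto intro: is_fieldD[OF K])
  show "p \<in> polys_over K \<Longrightarrow> q \<in> polys_over K \<Longrightarrow> p * q \<in> polys_over K"
    by (auto simp: coeff_mult intro!: sum is_fieldD(6)[OF K])
qed (auto intro: is_fieldD[OF K] simp: coeff_pCons split: nat.splits)

lemma polys_over_pcompose:
  assumes K: "is_field K" and "p \<in> polys_over K" and q: "q \<in> polys_over K"
  shows "pcompose p q \<in> polys_over K"
  using assms(2)
proof (induction p)
  case 0
  then show ?case by (simp add: is_fieldD[OF K])
next
  case (pCons c p)
  have "poly.coeff (pCons c p) (Suc i) \<in> K" for i using pCons.prems by blast
  moreover have "poly.coeff (pCons c p) 0 \<in> K" using pCons.prems by blast
  ultimately have "p \<in> polys_over K" "c \<in> K" by simp_all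
  with pCons.IH show ?case
    unfolding pcompose_pCons by (intro polys_over_closed[OF K] q) auto
qed

text \<open>
  The fractions form a field, so they contain everything that is generated.
\<close>

lemma field_adjoin_fraction:
  assumes K: "is_field K" and x: "x \<in> field_adjoin K a"
  obtains p q where "p \<in> polys_over K" "q \<in> polys_over K" "poly q a \<noteq> 0" "x = poly p a / poly q a"
proof -
  define L where "L = {x. \<exists>p\<in>polys_over K. \<exists>q\<in>polys_over K. poly q a \<noteq> 0 \<and> x = poly p a / poly q a}"
  have LI: "x \<in> L" if "p \<in> polys_over K" "q \<in> polys_over K" "poly q a \<noteq> 0" "x = poly p a / poly q a" for x p q
    unfolding L_def using that by blast
  note cl = polys_over_closed[OF K]
  have "is_field L"
  proof (rule is_fieldI)
    show "1 \<in> L" by (rule LI[of 1 1]) (use cl in auto)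
    fix x assume "x \<in> L"
    then obtain p q where pq: "p \<in> polys_over K" "q \<in> polys_over K" "poly q a \<noteq> 0" "x = poly p a / poly q a"
      unfolding L_def by blast
    show "- x \<in> L" by (rule LI[of "-p" q]) (use cl(5)[OF pq(1)] pq in auto)
    show "inverse x \<in> L" if "x \<noteq> 0" by (rule LI[of q p]) (use pq that in auto)
    fix y assume "y \<in> L"
    then obtain p' q' where pq': "p' \<in> polys_over K" "q' \<in> polys_over K" "poly q' a \<noteq> 0" "y = poly p' a / poly q' a"
      unfolding L_def by blast
    have "p * q' + p' * q \<in> polys_over K" "q * q' \<in> polys_over K" "p * p' \<in> polys_over K"
      by (intro cl pq pq')+
    moreover have "x + y = poly (p * q' + p' * q) a / poly (q * q') a"
      "x * y = poly (p * p') a / poly (q * q') a" "poly (q * q') a \<noteq> 0"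
      using pq pq' by (simp_all add: add_frac_eq)
    ultimately show "x + y \<in> L" "x * y \<in> L" using LI by blast+
  qed
  moreover have "K \<subseteq> L"
  proof
    fix x assume "x \<in> K"
    have "[:x:] \<in> polys_over K" "1 \<in> polys_over K" by (intro cl \<open>x \<in> K\<close>)+
    then show "x \<in> L" using LI[of "[:x:]" 1] by simp
  qed
  moreover have "a \<in> L"
  proof -
    have "[:0, 1:] \<in> polys_over K" "1 \<in> polys_over K" by (intro cl is_fieldD[OF K])+
    then show "a \<in> L" using LI[of "[:0, 1:]" 1] by simp
  qed
  ultimately have "x \<in> L" using field_adjoin_least x by blast
  then show ?thesis using that unfolding L_def by blast
qed

text \<open>
  With \<open>L = K + K b\<close> closed under inverses (multiply by the conjugate \<open>x - y b\<close>), \<open>L\<close> is the field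
  generated by \<open>b\<close>, and it is built from the line \<open>K\<close> by one line extension.
\<close>

lemma quadratic_extension_degree:
  fixes b :: "'a::field"
  assumes K: "is_field K" and b: "b \<notin> K" "b\<^sup>2 \<in> K"
  shows "extension_degree K (field_adjoin K b) 2"
proof -
  note cl = is_fieldD[OF K]
  define L where "L = {x + y * b | x y. x \<in> K \<and> y \<in> K}"
  have LI: "z \<in> L" if "x \<in> K" "y \<in> K" "z = x + y * b" for x y z
    unfolding L_def using that by blast
  have "is_field L"
  proof (rule is_fieldI)
    show "1 \<in> L" by (rule LI[of 1 0]) (auto intro: cl)
    fix z assume "z \<in> L"
    then obtain x y where z: "x \<in> K" "y \<in> K" "z = x + y * b" unfolding L_def by blast
    show "- z \<in> L" by (rule LI[of "-x" "-y"]) (auto intro: cl z(1,2) simp: z(3))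
    show "inverse z \<in> L" if "z \<noteq> 0"
    proof -
      have conj: "x - y * b \<noteq> 0"
      proof
        assume "x - y * b = 0"
        with that z have "y \<noteq> 0" by auto
        with \<open>x - y * b = 0\<close> have "b = x / y" by (simp add: field_simps)
        then show False using b(1) cl(8)[OF z(1,2)] by simp
      qed
      define N where "N = x\<^sup>2 - y\<^sup>2 * b\<^sup>2"
      have N: "z * (x - y * b) = N" by (simp add: z N_def algebra_simps power2_eq_square)
      then have "N \<noteq> 0" using conj that by auto
      then have "inverse z = (x - y * b) / N" using N that by (simp add: field_simps)
      then have "inverse z = x / N + (- y / N) * b" by (simp add: diff_divide_distrib)
      moreover have "N \<in> K" unfolding N_def by (intro cl is_field_power[OF K] z b)
      ultimately show ?thesis by (intro LI[of "x / N" "- y / N"] cl z)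
    qed
    fix w assume "w \<in> L"
    then obtain u v where w: "u \<in> K" "v \<in> K" "w = u + v * b" unfolding L_def by blast
    show "z + w \<in> L" by (rule LI[of "x + u" "y + v"]) (auto intro: cl z(1,2) w(1,2) simp: z(3) w(3) algebra_simps)
    have "z * w = (x * u + y * v * b\<^sup>2) + (x * v + y * u) * b"
      by (simp add: z(3) w(3) algebra_simps power2_eq_square)
    then show "z * w \<in> L" by (rule LI[rotated 2]) (intro cl z w b)+
  qed
  moreover have KL: "K \<subseteq> L" using LI[of _ 0] cl(2) by auto
  moreover have "b \<in> L" using LI[of 0 1] cl(1,2) by auto
  moreover have "L \<subseteq> field_adjoin K b"
    unfolding L_def by (auto intro: is_fieldD[OF field_adjoin_is_field] field_adjoin_base field_adjoin_elem)
  ultimately have L: "field_adjoin K b = L" using field_adjoin_least[of L K b] by blast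
  have "ring.dimension (ring_of_type_algebra :: 'a ring) 1 K K" by (rule ring.dimension_one[OF type_ring K])
  then have "ring.dimension (ring_of_type_algebra :: 'a ring) (Suc 1) K (ring.line_extension (ring_of_type_algebra :: 'a ring) K b K)"
    by (rule ring.Suc_dim[OF type_ring, rotated 2]) (use b in auto)
  moreover have "ring.line_extension (ring_of_type_algebra :: 'a ring) K b K = L"
    unfolding ring.line_extension_def[OF type_ring] L_def set_add_def' r_coset_def
    by (auto simp: add.commute) 
  ultimately show ?thesis
    unfolding extension_degree_def using K field_adjoin_is_field[of K b] KL L by (simp add: numeral_2_eq_2)
qed

section \<open>Polynomials irreducible over a subfield\<close>

lemma poly_ring_over_simps [simp]:
  "carrier (poly_ring_over K) = polys_over K"
  "p \<otimes>\<^bsub>poly_ring_over K\<^esub> q = p * q" "\<one>\<^bsub>poly_ring_over K\<^esub> = 1"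
  by (simp_all add: poly_ring_over_def ring_of_type_algebra_def)

text \<open>
  Division with remainder takes place in the polynomial ring of the ambient field; its recursion
  on the dividend only uses field operations on the coefficients, hence never leaves \<open>K\<close>.
\<close>

lemma polys_over_div_mod:
  assumes K: "is_field K" and m: "m \<in> polys_over K" and "p \<in> polys_over K"
  shows "p div m \<in> polys_over K" "p mod m \<in> polys_over K"
proof -
  have "p div m \<in> polys_over K \<and> p mod m \<in> polys_over K"
    using assms(3)
  proof (induction p)
    case 0
    then show ?case by (simp add: is_fieldD[OF K])
  next
    case (pCons c p)
    have "poly.coeff (pCons c p) (Suc i) \<in> K" for i using pCons.prems by blast
    moreover have c: "poly.coeff (pCons c p) 0 \<in> K" using pCons.prems by blast
    ultimately have IH: "p div m \<in> polys_over K" "p mod m \<in> polys_over K"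
      using pCons.IH by simp_all
    have c: "c \<in> K" using c by simp
    have r: "pCons c (p mod m) \<in> polys_over K" by (intro polys_over_closed[OF K] c IH)
    define b where "b = poly.coeff (pCons c (p mod m)) (Polynomial.degree m) / Polynomial.lead_coeff m"
    have b: "b \<in> K" unfolding b_def using r m by (intro is_fieldD(8)[OF K]) blast+
    show ?case
    proof (cases "m = 0")
      case True
      then show ?thesis using pCons.prems polys_over_closed(1)[OF K] by simp
    next
      case False
      then have "pCons c p div m = pCons b (p div m)"
        "pCons c p mod m = pCons c (p mod m) - Polynomial.smult b m"
        unfolding b_def by (simp_all only: div_pCons_eq mod_pCons_eq if_False)
      then show ?thesis using polys_over_closed[OF K] b IH r m by presburger
    qed
  qed
  then show "p div m \<in> polys_over K" "p mod m \<in> polys_over K" by auto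
qed

text \<open>
  A polynomial over \<open>K\<close> of least degree vanishing at \<open>z\<close> divides the irreducible \<open>p\<close>, and is
  therefore associated to it.
\<close>

lemma irreducible_over_degree_le:
  fixes p g :: "'a::field poly"
  assumes K: "is_field K" and p: "irreducible_over K p" "poly p z = 0"
    and g: "g \<in> polys_over K" "g \<noteq> 0" "poly g z = 0"
  shows "Polynomial.degree p \<le> Polynomial.degree g"
proof -
  define A where "A = (\<lambda>m. m \<in> polys_over K \<and> m \<noteq> 0 \<and> poly m z = 0)"
  have "A g" using g by (simp add: A_def)
  then obtain m where "A m" and min: "\<And>h. A h \<Longrightarrow> Polynomial.degree m \<le> Polynomial.degree h"
    using ex_has_least_nat[of A g Polynomial.degree] by blast
  then have m: "m \<in> polys_over K" "m \<noteq> 0" "poly m z = 0" by (simp_all add: A_def)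
  have pK: "p \<in> polys_over K" using p(1) by (simp add: irreducible_over_def)
  note dm = polys_over_div_mod[OF K m(1) pK]
  have "poly (p mod m) z = 0"
    using p(2) m(3) by (metis add_0 div_mult_mod_eq mult_zero_right poly_add poly_mult)
  then have "p mod m = 0"
    using min[of "p mod m"] dm(2) degree_mod_less[OF m(2), of p] unfolding A_def by (meson leD)
  then have pm: "p = m * (p div m)" by (metis dvd_mult_div_cancel mod_eq_0_iff_dvd)
  have "m \<notin> Units (poly_ring_over K)"
  proof
    assume "m \<in> Units (poly_ring_over K)"
    then obtain m' where "m' * m = 1" unfolding Units_def by auto
    then have "poly (m' * m) z = 1" by simp
    then show False using m(3) by simp
  qed
  then have "\<not> properfactor (poly_ring_over K) m p"
    using p(1) m(1) unfolding irreducible_over_def ring_irreducible_def Divisibility.irreducible_def by auto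
  moreover have "m divides\<^bsub>poly_ring_over K\<^esub> p"
    unfolding factor_def using pm dm(1) by auto
  ultimately obtain s where "m = p * s"
    unfolding properfactor_def factor_def by auto
  then have "Polynomial.degree p \<le> Polynomial.degree m"
    using m(2) by (metis dvd_imp_degree_le dvd_triv_left)
  also have "\<dots> \<le> Polynomial.degree g" by (rule min) fact
  finally show ?thesis .
qed

section \<open>Pulling back polynomials along the angle doubling map\<close>

text \<open>
  The polynomial \<open>2 y\<^sup>2 - 1\<close> is the second Chebyshev polynomial: it maps \<open>cos (t / 2)\<close> to \<open>cos t\<close>.
\<close>

definition double_angle :: "'a::comm_ring_1 poly \<Rightarrow> 'a poly" where
  "double_angle p = pcompose p [:-1, 0, 2:]"

lemma poly_double_angle: "poly (double_angle p) x = poly p (2 * x\<^sup>2 - 1)"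
  by (simp add: double_angle_def poly_pcompose power2_eq_square algebra_simps)

lemma double_angle_eq_0_iff [simp]: "double_angle p = 0 \<longleftrightarrow> p = (0 :: 'a::field_char_0 poly)"
  by (simp add: double_angle_def pcompose_eq_0_iff)

lemma double_angle_mult: "double_angle (p * q) = double_angle p * double_angle q"
  by (simp add: double_angle_def pcompose_mult)

lemma double_angle_power: "double_angle (p ^ n) = double_angle p ^ n"
  by (induction n) (simp_all add: double_angle_mult, simp add: double_angle_def pcompose_1)

lemma order_power: "p \<noteq> (0::'a::idom poly) \<Longrightarrow> Polynomial.order a (p ^ n) = n * Polynomial.order a p"
  by (induction n) (simp_all add: Polynomial.order_mult)

lemma order_linear: "Polynomial.order a [:- b, 1:] = (if a = b then 1 else (0::nat))" for a :: "'a::idom"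
  using order_power_n_n[of a 1] by (auto intro: order_0I)

text \<open>
  The ramification of angle doubling: \<open>2 y\<^sup>2 - 2 s\<^sup>2 = 2 (y - s) (y + s)\<close> has a simple root at \<open>s\<close>
  unless \<open>s = 0\<close>, when the root is double.
\<close>

lemma order_double_angle:
  fixes p :: "'a::field_char_0 poly"
  assumes "p \<noteq> 0"
  shows "Polynomial.order s (double_angle p) = (if s = 0 then 2 else 1) * Polynomial.order (2 * s\<^sup>2 - 1) p"
proof -
  define \<rho> where "\<rho> = 2 * s\<^sup>2 - 1"
  obtain t where t: "p = [:- \<rho>, 1:] ^ Polynomial.order \<rho> p * t" "\<not> [:- \<rho>, 1:] dvd t"
    using order_decomp[OF assms] by blast
  have "poly t \<rho> \<noteq> 0" using t(2) by (simp add: poly_eq_0_iff_dvd)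
  then have "poly (double_angle t) s \<noteq> 0" by (simp add: poly_double_angle \<rho>_def)
  then have t0: "Polynomial.order s (double_angle t) = 0" "double_angle t \<noteq> 0"
    by (rule order_0I) (use \<open>poly t \<rho> \<noteq> 0\<close> in auto)
  define l where "l = double_angle [:- \<rho>, 1:]"
  have l: "l = Polynomial.smult 2 ([:- s, 1:] * [:- (- s), 1:])"
    by (simp add: l_def double_angle_def pcompose_pCons \<rho>_def power2_eq_square)
  have "l \<noteq> 0" by (simp add: l_def)
  have "Polynomial.order s l = Polynomial.order s [:- s, 1:] + Polynomial.order s [:- (- s), 1:]"
    unfolding l by (subst order_smult, simp, subst Polynomial.order_mult) auto
  then have ol: "Polynomial.order s l = (if s = 0 then 2 else 1)"
    unfolding order_linear by simp
  have "double_angle p = l ^ Polynomial.order \<rho> p * double_angle t"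
    unfolding l_def by (subst t(1)) (simp add: double_angle_mult double_angle_power)
  then have "Polynomial.order s (double_angle p) = Polynomial.order \<rho> p * Polynomial.order s l"
    using \<open>l \<noteq> 0\<close> t0 by (simp add: Polynomial.order_mult order_power)
  then show ?thesis unfolding ol \<rho>_def by simp
qed

text \<open>
  The principal square root of \<open>(s + 1) / 2\<close> is a preimage of \<open>s\<close> with nonnegative real part. It
  is nonzero unless \<open>s = -1\<close>, so the chain of preimages never meets the ramification point.
\<close>

lemma order_double_angle_iterate:
  assumes "Re \<rho> \<ge> 0"
  obtains s where "Re s \<ge> 0"
    "\<And>p. p \<noteq> 0 \<Longrightarrow> Polynomial.order s ((double_angle ^^ j) p) = Polynomial.order \<rho> p"
proof -
  have "\<exists>s. Re s \<ge> 0 \<and> (\<forall>p. p \<noteq> 0 \<longrightarrow> Polynomial.order s ((double_angle ^^ j) p) = Polynomial.order \<rho> p)"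
  proof (induction j)
    case 0
    then show ?case using assms by auto
  next
    case (Suc j)
    then obtain s where s: "Re s \<ge> 0"
      "\<And>p. p \<noteq> 0 \<Longrightarrow> Polynomial.order s ((double_angle ^^ j) p) = Polynomial.order \<rho> p" by blast
    define s' where "s' = csqrt ((s + 1) / 2)"
    have "2 * s'\<^sup>2 - 1 = s" by (simp add: s'_def)
    moreover have "s' \<noteq> 0"
    proof
      assume "s' = 0"
      with \<open>2 * s'\<^sup>2 - 1 = s\<close> have "Re s = -1" by auto
      then show False using s(1) by simp
    qed
    moreover have "(double_angle ^^ j) p \<noteq> 0" if "p \<noteq> 0" for p :: "complex poly"
      using that by (induction j) auto
    moreover have "Re s' \<ge> 0" unfolding s'_def by (rule Re_csqrt)
    ultimately show ?case using s(2) by (intro exI[of _ s']) (simp add: order_double_angle)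
  qed
  then show ?thesis using that by blast
qed

lemma complex_poly_same_orders:
  fixes p q :: "complex poly"
  assumes "p \<noteq> 0" "q \<noteq> 0" "\<And>z. Polynomial.order z p = Polynomial.order z q"
  shows "p = Polynomial.smult (Polynomial.lead_coeff p / Polynomial.lead_coeff q) q"
proof -
  have roots: "{z. poly p z = 0} = {z. poly q z = 0}"
    using assms by (simp add: order_root)
  define P where "P = (\<Prod>z | poly q z = 0. [:- z, 1:] ^ Polynomial.order z q)"
  have "p = Polynomial.smult (Polynomial.lead_coeff p) P"
    using complex_poly_decompose[of p] unfolding roots assms(3) P_def by simp
  moreover have "Polynomial.smult (Polynomial.lead_coeff q) P = q"
    unfolding P_def by (rule complex_poly_decompose)
  ultimately show ?thesis using assms(2)
    by (metis leading_coeff_0_iff nonzero_eq_divide_eq smult_smult)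
qed

section \<open>Perfect powers of rational numbers\<close>

text \<open>
  In lowest terms, \<open>(a / b)\<^sup>n = u / v\<close> makes \<open>a\<^sup>n\<close> divide \<open>u\<close> and \<open>b\<^sup>n\<close> divide \<open>v\<close>; unless
  \<open>a / b\<close> is \<open>0\<close> or \<open>\<plusminus>1\<close>, one of the two powers is at least \<open>2\<^sup>n\<close>.
\<close>

lemma finite_rational_exponents:
  fixes c :: rat
  assumes "c \<noteq> 0" "c \<noteq> 1" "c \<noteq> -1"
  shows "finite {n. \<exists>x. x ^ n = c}"
proof -
  obtain u v where uv: "quotient_of c = (u, v)" by fastforce
  have c: "c = of_int u / of_int v" "v > 0"
    using quotient_of_div[OF uv] quotient_of_denom_pos[OF uv] by auto
  then have "u \<noteq> 0" using assms(1) by auto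
  have "n \<le> nat (max \<bar>u\<bar> v)" if x: "x ^ n = c" for n x
  proof -
    obtain a b where ab: "quotient_of x = (a, b)" by fastforce
    have x': "x = of_int a / of_int b" "b > 0" "coprime a b"
      using quotient_of_div[OF ab] quotient_of_denom_pos[OF ab] quotient_of_coprime[OF ab] by auto
    have "of_int (a ^ n * v) = (of_int (u * b ^ n) :: rat)"
      using x c x' by (simp add: power_divide field_simps)
    then have eq: "a ^ n * v = u * b ^ n" by (simp only: of_int_eq_iff)
    have cop: "coprime (a ^ n) (b ^ n)" using x'(3) by simp
    have "a ^ n dvd u * b ^ n" using eq by (metis dvd_triv_left)
    then have "a ^ n dvd u" using cop by (simp add: coprime_dvd_mult_left_iff)
    then have au: "\<bar>a\<bar> ^ n \<le> \<bar>u\<bar>" using \<open>u \<noteq> 0\<close>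
      by (metis dvd_imp_le_int power_abs)
    have "b ^ n dvd a ^ n * v" using eq by simp
    then have "b ^ n dvd v" using cop by (simp add: coprime_dvd_mult_right_iff coprime_commute)
    then have bv: "b ^ n \<le> v" using c(2) by (simp add: zdvd_imp_le)
    have pow: "int n \<le> y ^ n" if "2 \<le> y" for y :: int
    proof -
      have "int n \<le> 2 ^ n" using less_exp[of n] by (metis less_imp_le of_nat_le_iff of_nat_numeral of_nat_power)
      also have "\<dots> \<le> y ^ n" using that by (intro power_mono) auto
      finally show ?thesis .
    qed
    consider "\<bar>a\<bar> \<ge> 2" | "b \<ge> 2" | "a = 0" | "\<bar>a\<bar> = 1" "b = 1" using x'(2) by linarith
    then show ?thesis
    proof cases
      case 1
      then show ?thesis using pow[of "\<bar>a\<bar>"] au by linarith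
    next
      case 2
      then show ?thesis using pow[of b] bv by linarith
    next
      case 3
      then have "n = 0" using x x' assms(1) by (cases n) auto
      then show ?thesis by simp
    next
      case 4
      then have "x = 1 \<or> x = -1" using x' by (auto simp: abs_if split: if_splits)
      then have "c = 1 \<or> c = -1" using x by (cases "even n") auto
      then show ?thesis using assms by auto
    qed
  qed
  then have "{n. \<exists>x. x ^ n = c} \<subseteq> {..nat (max \<bar>u\<bar> v)}" by blast
  then show ?thesis by (rule finite_subset) simp
qed

section \<open>Algebraic numbers\<close>

lemma even_odd_decomposition:
  assumes K: "is_field K" and "p \<in> polys_over K"
  obtains a b where "a \<in> polys_over K" "b \<in> polys_over K"
    "\<And>x. poly p x = poly a (x\<^sup>2) + x * poly b (x\<^sup>2)" "p \<noteq> 0 \<Longrightarrow> a \<noteq> 0 \<or> b \<noteq> 0"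
proof -
  have "\<exists>a\<in>polys_over K. \<exists>b\<in>polys_over K. (\<forall>x. poly p x = poly a (x\<^sup>2) + x * poly b (x\<^sup>2)) \<and>
    (p \<noteq> 0 \<longrightarrow> a \<noteq> 0 \<or> b \<noteq> 0)"
    using assms(2)
  proof (induction p)
    case 0
    then show ?case by (intro bexI[of _ 0]) (auto simp: is_fieldD[OF K])
  next
    case (pCons c p)
    have "poly.coeff (pCons c p) (Suc i) \<in> K" for i using pCons.prems by blast
    moreover have c: "poly.coeff (pCons c p) 0 \<in> K" using pCons.prems by blast
    ultimately have "p \<in> polys_over K" "c \<in> K" by simp_all
    then obtain a b where ab: "a \<in> polys_over K" "b \<in> polys_over K"
      "\<And>x. poly p x = poly a (x\<^sup>2) + x * poly b (x\<^sup>2)" "p \<noteq> 0 \<longrightarrow> a \<noteq> 0 \<or> b \<noteq> 0"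
      using pCons.IH by blast
    have "pCons c b \<in> polys_over K" by (intro polys_over_closed[OF K] \<open>c \<in> K\<close> ab)
    then show ?case using ab pCons.hyps
      by (intro bexI[of _ "pCons c b"] bexI[of _ a]) (auto simp: algebra_simps power2_eq_square)
  qed
  then show ?thesis using that by blast
qed

text \<open>
  If \<open>p(x) = a(x\<^sup>2) + x b(x\<^sup>2)\<close>, the norm \<open>a(y)\<^sup>2 - y b(y)\<^sup>2\<close> of \<open>p\<close> over the even polynomials vanishes at
  \<open>x\<^sup>2\<close>. It is nonzero because its two terms have degrees of different parity.
\<close>

lemma algebraic_power2:
  fixes x :: "'a::field_char_0"
  assumes "algebraic x"
  shows "algebraic (x\<^sup>2)"
proof -
  note Q = is_field_Rats[where 'a='a]
  from assms obtain p where p: "p \<in> polys_over \<rat>" "p \<noteq> 0" "poly p x = 0"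
    unfolding algebraic_altdef by blast
  obtain a b where ab: "a \<in> polys_over \<rat>" "b \<in> polys_over \<rat>"
    "poly p x = poly a (x\<^sup>2) + x * poly b (x\<^sup>2)" "a \<noteq> 0 \<or> b \<noteq> 0"
    by (rule even_odd_decomposition[OF Q p(1)]) (use p(2) in blast)
  define N where "N = a * a - pCons 0 (b * b)"
  have N: "N \<in> polys_over \<rat>" unfolding N_def by (intro polys_over_closed(4,6,8)[OF Q] ab is_fieldD(2)[OF Q])
  have "poly a (x\<^sup>2) = - (x * poly b (x\<^sup>2))" using ab(3) p(3) by (simp add: eq_neg_iff_add_eq_0)
  then have "poly N (x\<^sup>2) = 0" by (simp add: N_def power2_eq_square)
  moreover have "N \<noteq> 0"
  proof
    assume "N = 0"
    then have eq: "a * a = pCons 0 (b * b)" by (simp add: N_def)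
    then have "b \<noteq> 0" "a \<noteq> 0" using ab(4) by auto
    then have "2 * Polynomial.degree a = Suc (2 * Polynomial.degree b)"
      using arg_cong[OF eq, of Polynomial.degree] by (simp add: Polynomial.degree_mult_eq)
    then show False by presburger
  qed
  ultimately show ?thesis using N unfolding algebraic_altdef by blast
qed

lemma algebraic_double:
  fixes x :: "'a::field_char_0"
  assumes "algebraic x"
  shows "algebraic (2 * x\<^sup>2 - 1)"
proof -
  note Q = is_field_Rats[where 'a='a]
  from algebraic_power2[OF assms] obtain p where p: "p \<in> polys_over \<rat>" "p \<noteq> 0" "poly p (x\<^sup>2) = 0"
    unfolding algebraic_altdef by blast
  have "[:1 / 2, 1 / 2:] \<in> polys_over (\<rat> :: 'a set)" by (intro polys_over_closed[OF Q]) auto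
  from polys_over_pcompose[OF Q p(1) this]
  have "pcompose p [:1 / 2, 1 / 2:] \<in> polys_over \<rat>" .
  moreover have "pcompose p [:1 / 2, 1 / 2:] \<noteq> 0" using p(2) by (simp add: pcompose_eq_0_iff)
  moreover have "poly (pcompose p [:1 / 2, 1 / 2:]) (2 * x\<^sup>2 - 1) = 0"
    using p(3) by (simp add: poly_pcompose field_simps)
  ultimately show ?thesis unfolding algebraic_altdef by blast
qed

lemma countable_algebraic: "countable {x::'a::field_char_0. algebraic x}"
proof -
  have "countable (\<int> :: 'a set)" unfolding Ints_def by (rule countable_image) simp
  then have "countable (lists (\<int> :: 'a set))" by (rule countable_lists)
  then have "countable (Poly ` lists (\<int> :: 'a set) - {0})" by blast
  then have "countable (\<Union>p \<in> Poly ` lists (\<int> :: 'a set) - {0}. {x. poly p x = 0})"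
    by (intro countable_UN) (auto intro: countable_finite poly_roots_finite)
  moreover have "{x::'a. algebraic x} \<subseteq> (\<Union>p \<in> Poly ` lists (\<int> :: 'a set) - {0}. {x. poly p x = 0})"
  proof
    fix x :: 'a assume "x \<in> {x. algebraic x}"
    then obtain p where p: "\<And>i. poly.coeff p i \<in> \<int>" "p \<noteq> 0" "poly p x = 0"
      unfolding algebraic_def by blast
    then have "coeffs p \<in> lists \<int>" by (auto simp: in_lists_conv_set coeffs_def)
    then have "p \<in> Poly ` lists \<int>" by (metis Poly_coeffs image_eqI)
    with p show "x \<in> (\<Union>p \<in> Poly ` lists (\<int> :: 'a set) - {0}. {x. poly p x = 0})" by auto
  qed
  ultimately show ?thesis by (rule countable_subset[rotated])
qed

section \<open>Roots in a tower of rational function fields\<close>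

lemma polys_over_double_angle:
  assumes K: "is_field K" and "p \<in> polys_over K"
  shows "double_angle p \<in> polys_over K"
proof -
  have "1 + 1 \<in> K" by (intro is_fieldD(1,5)[OF K])
  then have "2 \<in> K" by simp
  then have "[:-1, 0, 2:] \<in> polys_over K"
    by (intro polys_over_closed(1,8)[OF K] is_fieldD(1,2,3)[OF K])
  then show ?thesis unfolding double_angle_def by (rule polys_over_pcompose[OF assms])
qed

text \<open>
  The two properties of the numbers \<open>cos (\<alpha> / 2\<^sup>m)\<close> on which rootlessness rests. Transcendence at the
  bottom propagates upwards, since angle doubling preserves algebraic numbers.
\<close>

locale transcendental_tower =
  fixes c :: "nat \<Rightarrow> complex"
  assumes double: "c m = 2 * (c (Suc m))\<^sup>2 - 1"
    and transcendental_0: "\<not> algebraic (c 0)"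
begin

lemma transcendental: "\<not> algebraic (c m)"
proof (induction m)
  case (Suc m)
  then show ?case using algebraic_double[of "c (Suc m)"] double[of m] by auto
qed (rule transcendental_0)

lemma poly_eq_0_at:
  assumes "p \<in> polys_over \<rat>" "poly p (c m) = 0"
  shows "p = 0"
  using transcendental[of m] assms unfolding algebraic_altdef by blast

definition level :: "nat \<Rightarrow> complex set" where
  "level m = field_adjoin \<rat> (c m)"

lemma level_is_field: "is_field (level m)"
  unfolding level_def by (rule field_adjoin_is_field)

lemma level_elem: "c m \<in> level m"
  unfolding level_def by (rule field_adjoin_elem)

lemma level_Suc: "level m \<subseteq> level (Suc m)"
proof -
  have "1 + 1 \<in> level (Suc m)" by (intro is_fieldD(1,5)[OF level_is_field])
  then have "2 \<in> level (Suc m)" by simp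
  then have "c m \<in> level (Suc m)" unfolding double[of m]
    by (intro is_fieldD(1,6,7)[OF level_is_field] is_field_power[OF level_is_field] level_elem)
  then show ?thesis using field_adjoin_least[OF level_is_field Rats_subset_field[OF level_is_field]]
    unfolding level_def[of m] by blast
qed

lemma level_mono: "m \<le> k \<Longrightarrow> level m \<subseteq> level k"
  by (rule lift_Suc_mono_le[of level]) (rule level_Suc)

lemma level_fraction:
  assumes "x \<in> level m"
  obtains p q where "p \<in> polys_over \<rat>" "q \<in> polys_over \<rat>" "q \<noteq> 0"
    "poly q (c m) \<noteq> 0" "x = poly p (c m) / poly q (c m)"
proof (rule field_adjoin_fraction[OF is_field_Rats assms[unfolded level_def]])
  fix p q assume "p \<in> polys_over \<rat>" "q \<in> polys_over \<rat>"
    "poly q (c m) \<noteq> 0" "x = poly p (c m) / poly q (c m)"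
  moreover from this have "q \<noteq> 0" by auto
  ultimately show thesis using that by blast
qed

lemma polys_over_double_angle_iterate: "p \<in> polys_over \<rat> \<Longrightarrow> (double_angle ^^ j) p \<in> polys_over (\<rat> :: complex set)"
proof (induction j)
  case (Suc j)
  then have "double_angle ((double_angle ^^ j) p) \<in> polys_over (\<rat> :: complex set)"
    by (intro polys_over_double_angle[OF is_field_Rats])
  then show ?case by (simp only: funpow.simps o_apply)
qed (simp only: funpow.simps id_apply)

lemma double_angle_iterate_eq_0_iff: "(double_angle ^^ j) p = 0 \<longleftrightarrow> p = (0 :: complex poly)"
  by (induction j) auto

lemma poly_double_angle_iterate: "poly ((double_angle ^^ j) p) (c (m + j)) = poly p (c m)"
proof (induction j)
  case (Suc j)
  then show ?case using double[of "m + j"] by (simp add: poly_double_angle)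
qed simp

text \<open>
  Clearing denominators in \<open>x\<^sup>n = p(c\<^sub>m) / q(c\<^sub>m)\<close> gives an identity between polynomials in
  \<open>c\<^sub>m\<^sub>+\<^sub>j\<close>, which holds formally by transcendence. Comparing orders at an unramified point over \<open>\<rho>\<close>
  shows that \<open>n\<close> divides the order of \<open>p / q\<close> at \<open>\<rho>\<close>.
\<close>

lemma exponent_le_order_difference:
  assumes p: "p \<in> polys_over \<rat>" "p \<noteq> 0" and q: "q \<in> polys_over \<rat>" "q \<noteq> 0"
    and rho: "Re \<rho> \<ge> 0" "Polynomial.order \<rho> p \<noteq> Polynomial.order \<rho> q"
    and x: "x \<in> level (m + j)" "x ^ n = poly p (c m) / poly q (c m)"
  shows "n \<le> nat \<bar>int (Polynomial.order \<rho> p) - int (Polynomial.order \<rho> q)\<bar>"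
proof (cases "n = 0")
  case False
  obtain r s where rs: "r \<in> polys_over \<rat>" "s \<in> polys_over \<rat>" "s \<noteq> 0"
    "poly s (c (m + j)) \<noteq> 0" "x = poly r (c (m + j)) / poly s (c (m + j))"
    by (rule level_fraction[OF x(1)])
  have nz: "poly p (c m) \<noteq> 0" "poly q (c m) \<noteq> 0"
    using poly_eq_0_at p q by blast+
  then have "x \<noteq> 0" using x(2) False by (auto simp: power_0_left)
  then have "r \<noteq> 0" using rs by auto
  define p' q' where "p' = (double_angle ^^ j) p" and "q' = (double_angle ^^ j) q"
  have pq': "p' \<in> polys_over \<rat>" "q' \<in> polys_over \<rat>" "p' \<noteq> 0" "q' \<noteq> 0"
    "poly p' (c (m + j)) = poly p (c m)" "poly q' (c (m + j)) = poly q (c m)"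
    using p q unfolding p'_def q'_def
    by (simp_all only: polys_over_double_angle_iterate double_angle_iterate_eq_0_iff poly_double_angle_iterate not_False_eq_True)
  note cl = polys_over_closed[OF is_field_Rats]
  have pow: "t ^ n \<in> polys_over \<rat>" if "t \<in> polys_over \<rat>" for t :: "complex poly"
    by (induction n) (simp_all only: power_0 power_Suc cl that)
  have "r ^ n * q' - s ^ n * p' \<in> polys_over \<rat>"
    by (intro cl pow rs pq')
  moreover have "poly (r ^ n * q' - s ^ n * p') (c (m + j)) = 0"
    using x(2) nz rs pq' by (simp add: power_divide field_simps)
  ultimately have eq: "r ^ n * q' = s ^ n * p'" using poly_eq_0_at by fastforce
  obtain \<sigma> where \<sigma>: "\<And>p. p \<noteq> 0 \<Longrightarrow> Polynomial.order \<sigma> ((double_angle ^^ j) p) = Polynomial.order \<rho> p"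
    by (rule order_double_angle_iterate[OF rho(1), of j]) blast
  have "n * Polynomial.order \<sigma> r + Polynomial.order \<rho> q = n * Polynomial.order \<sigma> s + Polynomial.order \<rho> p"
    using arg_cong[OF eq, of "Polynomial.order \<sigma>"] \<open>r \<noteq> 0\<close> rs(3) pq'(3,4) \<sigma>[OF p(2)] \<sigma>[OF q(2)]
    by (simp add: Polynomial.order_mult order_power p'_def q'_def)
  then have "int n * (int (Polynomial.order \<sigma> r) - int (Polynomial.order \<sigma> s)) =
      int (Polynomial.order \<rho> p) - int (Polynomial.order \<rho> q)"
    unfolding right_diff_distrib by (simp flip: of_nat_mult)
  then have "int n dvd int (Polynomial.order \<rho> p) - int (Polynomial.order \<rho> q)"
    by (metis dvd_triv_left)
  then have "int n \<le> \<bar>int (Polynomial.order \<rho> p) - int (Polynomial.order \<rho> q)\<bar>"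
    using rho(2) dvd_imp_le_int[of "int (Polynomial.order \<rho> p) - int (Polynomial.order \<rho> q)" "int n"] by simp
  then show ?thesis by linarith
qed simp

text \<open>
  Without zeros and poles a rational function is constant, here the ratio of leading coefficients.
\<close>

lemma rational_if_same_orders:
  assumes "p \<in> polys_over \<rat>" "q \<in> polys_over \<rat>" "p \<noteq> 0" "q \<noteq> 0"
    and "\<And>z. Polynomial.order z p = Polynomial.order z q"
  shows "poly p (c m) / poly q (c m) \<in> \<rat>"
proof -
  define d where "d = Polynomial.lead_coeff p / Polynomial.lead_coeff q"
  have "p = Polynomial.smult d q"
    unfolding d_def by (rule complex_poly_same_orders[OF assms(3-5)])
  moreover have "d \<in> \<rat>" unfolding d_def using assms(1,2) by (intro Rats_divide) auto
  moreover have "poly q (c m) \<noteq> 0" using poly_eq_0_at assms by blast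
  ultimately show ?thesis by simp
qed

text \<open>
  If \<open>(r / s)\<^sup>n\<close> is constant then so is \<open>r / s\<close>, since all its orders vanish.
\<close>

lemma root_of_rational_is_rational:
  assumes x: "x \<in> level k" "x ^ n = d" and d: "d \<in> \<rat>" "d \<noteq> 0" and n: "n \<ge> 1"
  shows "x \<in> \<rat>"
proof -
  obtain r s where rs: "r \<in> polys_over \<rat>" "s \<in> polys_over \<rat>" "s \<noteq> 0"
    "poly s (c k) \<noteq> 0" "x = poly r (c k) / poly s (c k)"
    by (rule level_fraction[OF x(1)])
  have "x \<noteq> 0" using x d n by (auto simp: power_0_left)
  then have "r \<noteq> 0" using rs by auto
  note cl = polys_over_closed[OF is_field_Rats]
  have pow: "t ^ n \<in> polys_over \<rat>" if "t \<in> polys_over \<rat>" for t :: "complex poly"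
    by (induction n) (simp_all only: power_0 power_Suc cl that)
  have "r ^ n - Polynomial.smult d (s ^ n) \<in> polys_over \<rat>"
    by (intro cl pow rs d)
  moreover have "poly (r ^ n - Polynomial.smult d (s ^ n)) (c k) = 0"
    using x(2) rs by (simp add: power_divide field_simps)
  ultimately have eq: "r ^ n = Polynomial.smult d (s ^ n)" using poly_eq_0_at by fastforce
  have "Polynomial.order z r = Polynomial.order z s" for z
    using arg_cong[OF eq, of "Polynomial.order z"] \<open>r \<noteq> 0\<close> rs(3) d(2) n
    by (simp add: order_smult order_power)
  then show ?thesis
    using rational_if_same_orders[OF rs(1,2) \<open>r \<noteq> 0\<close> rs(3)] rs(5) by simp
qed

lemma finite_root_exponents:
  assumes f: "f \<in> level m" "f \<noteq> 0" "f \<noteq> 1" "f \<noteq> -1"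
  shows "finite {n. n \<ge> 1 \<and> (\<exists>k. \<exists>x\<in>level k. x ^ n = f)}"
proof -
  obtain p q where pq: "p \<in> polys_over \<rat>" "q \<in> polys_over \<rat>" "q \<noteq> 0"
    "poly q (c m) \<noteq> 0" "f = poly p (c m) / poly q (c m)"
    by (rule level_fraction[OF f(1)])
  have "p \<noteq> 0" using pq f by auto
  show ?thesis
  proof (cases "\<forall>z. Polynomial.order z p = Polynomial.order z q")
    case True
    then have "f \<in> \<rat>"
      unfolding pq(5) using rational_if_same_orders pq \<open>p \<noteq> 0\<close> by blast
    then obtain d where d: "f = of_rat d" by (auto elim: Rats_cases)
    have "n \<in> {n. \<exists>x. x ^ n = d}" if nx: "n \<ge> 1" "x \<in> level k" "x ^ n = f" for n x k
    proof -
      have "x \<in> \<rat>" using root_of_rational_is_rational[OF nx(2,3)] \<open>f \<in> \<rat>\<close> f nx(1) by blast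
      then obtain y where "x = of_rat y" by (auto elim: Rats_cases)
      then have "of_rat (y ^ n) = (of_rat d :: complex)" using nx(3) d by (simp add: of_rat_power)
      then show ?thesis by auto
    qed
    then have "{n. n \<ge> 1 \<and> (\<exists>k. \<exists>x\<in>level k. x ^ n = f)} \<subseteq> {n. \<exists>x. x ^ n = d}" by blast
    moreover have "d \<noteq> 0" "d \<noteq> 1" "d \<noteq> -1" using f d by auto
    ultimately show ?thesis using finite_rational_exponents finite_subset by blast
  next
    case False
    then obtain z where z: "Polynomial.order z p \<noteq> Polynomial.order z q" by blast
    \<comment> \<open>One step up the tower moves the zero or pole to the right half-plane. Its order may double, if \<open>z = -1\<close>.\<close>
    define \<rho> where "\<rho> = csqrt ((z + 1) / 2)"
    have "2 * \<rho>\<^sup>2 - 1 = z" by (simp add: \<rho>_def)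
    have "Re \<rho> \<ge> 0" unfolding \<rho>_def by (rule Re_csqrt)
    have ord: "Polynomial.order \<rho> (double_angle p) \<noteq> Polynomial.order \<rho> (double_angle q)"
      using z \<open>p \<noteq> 0\<close> pq(3) \<open>2 * \<rho>\<^sup>2 - 1 = z\<close> by (simp add: order_double_angle)
    define b where "b = nat \<bar>int (Polynomial.order \<rho> (double_angle p)) - int (Polynomial.order \<rho> (double_angle q))\<bar>"
    have f': "f = poly (double_angle p) (c (Suc m)) / poly (double_angle q) (c (Suc m))"
      using pq(5) poly_double_angle_iterate[of 1 _ m] by simp
    have "n \<le> b" if "x \<in> level k" "x ^ n = f" for n x k
    proof -
      have "x \<in> level (Suc m + k)" using that(1) level_mono[of k "Suc m + k"] by auto
      then show ?thesis unfolding b_def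
        using exponent_le_order_difference[OF polys_over_double_angle[OF is_field_Rats pq(1)] _
          polys_over_double_angle[OF is_field_Rats pq(2)] _ \<open>Re \<rho> \<ge> 0\<close> ord, of x "Suc m" k n]
          that(2) f' \<open>p \<noteq> 0\<close> pq(3) by simp
    qed
    then have "{n. n \<ge> 1 \<and> (\<exists>k. \<exists>x\<in>level k. x ^ n = f)} \<subseteq> {..b}" by blast
    then show ?thesis by (rule finite_subset) simp
  qed
qed

end

section \<open>Roots of unity and transcendental cosines\<close>

lemma is_field_Reals: "is_field (\<real> :: complex set)"
  by (rule is_fieldI) auto

lemma is_field_chain_Union:
  fixes L :: "nat \<Rightarrow> 'a::field set"
  assumes "\<And>n. is_field (L n)" "\<And>m n. m \<le> n \<Longrightarrow> L m \<subseteq> L n"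
  shows "is_field (\<Union>n\<in>{1..}. L n)"
proof (rule is_fieldI)
  show "1 \<in> (\<Union>n\<in>{1..}. L n)" using is_fieldD(1)[OF assms(1), of 1] by auto
  fix x assume "x \<in> (\<Union>n\<in>{1..}. L n)"
  then obtain m where m: "m \<ge> 1" "x \<in> L m" by auto
  show "- x \<in> (\<Union>n\<in>{1..}. L n)" using m is_fieldD(3)[OF assms(1) m(2)] by auto
  show "inverse x \<in> (\<Union>n\<in>{1..}. L n)" using m is_fieldD(4)[OF assms(1) m(2)] by auto
  fix y assume "y \<in> (\<Union>n\<in>{1..}. L n)"
  then obtain n where n: "y \<in> L n" by auto
  have xy: "x \<in> L (max m n)" "y \<in> L (max m n)"
    using assms(2)[of m "max m n"] assms(2)[of n "max m n"] m n by auto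
  show "x + y \<in> (\<Union>n\<in>{1..}. L n)" "x * y \<in> (\<Union>n\<in>{1..}. L n)"
    using is_fieldD(5,6)[OF assms(1) xy] m by (auto intro!: bexI[of _ "max m n"])
qed

lemma real_root_of_unity:
  assumes "z \<in> \<real>" "root_of_unity (z :: complex)"
  shows "z = 1 \<or> z = -1"
proof -
  obtain m where m: "m \<ge> 1" "z ^ m = 1" using assms(2) unfolding root_of_unity_def by blast
  obtain r where r: "z = of_real r" using assms(1) by (auto elim: Reals_cases)
  have "norm z = 1" using m power_eq_1_iff[OF m(2)] by auto
  then show ?thesis using r by (auto simp: abs_if split: if_splits)
qed

lemma not_root_of_unityD: "\<not> root_of_unity (f::complex) \<Longrightarrow> f \<noteq> 1 \<and> f \<noteq> -1"
  unfolding root_of_unity_def by (metis one_power2 one_le_numeral power2_minus)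

lemma not_root_of_unity_cis:
  assumes "\<alpha> / pi \<notin> \<rat>"
  shows "\<not> root_of_unity (cis \<alpha>)"
proof
  assume "root_of_unity (cis \<alpha>)"
  then obtain m :: nat where m: "m \<ge> 1" "cis (real m * \<alpha>) = 1"
    unfolding root_of_unity_def DeMoivre by blast
  then have "cos (real m * \<alpha>) = 1" by (simp add: complex_eq_iff)
  then obtain k :: int where "real m * \<alpha> = of_int k * 2 * pi" using cos_one_2pi_int by blast
  then have "\<alpha> / pi = of_int (2 * k) / of_nat m" using m(1) by (simp add: field_simps)
  also have "\<dots> \<in> \<rat>" by (intro Rats_divide Rats_of_int Rats_of_nat)
  finally show False using assms by simp
qed

text \<open>
  Both exceptional sets are countable, but \<open>{0..pi}\<close> is not: the multiples of \<open>pi\<close> are indexed by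
  \<open>\<rat>\<close>, and \<open>cos\<close> is injective on this interval, with inverse \<open>arccos\<close>.
\<close>

lemma exists_transcendental_cosine: "\<exists>\<alpha>::real. \<alpha> / pi \<notin> \<rat> \<and> \<not> algebraic (cos \<alpha>)"
proof (rule ccontr)
  assume none: "\<not> ?thesis"
  have "{0..pi} \<subseteq> (\<lambda>r. r * pi) ` \<rat> \<union> arccos ` {x. algebraic x}"
  proof
    fix x assume x: "x \<in> {0..pi}"
    from none consider "x / pi \<in> \<rat>" | "algebraic (cos x)" by blast
    then show "x \<in> (\<lambda>r. r * pi) ` \<rat> \<union> arccos ` {x. algebraic x}"
    proof cases
      case 1
      then show ?thesis by (intro UnI1 image_eqI[of _ _ "x / pi"]) auto
    next
      case 2
      then show ?thesis using x by (intro UnI2 image_eqI[of _ _ "cos x"]) (auto simp: arccos_cos)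
    qed
  qed
  moreover have "countable ((\<lambda>r. r * pi) ` \<rat> \<union> arccos ` {x. algebraic x})"
    using countable_rat countable_algebraic by (intro countable_Un countable_image)
  ultimately have "countable {0..pi}" by (rule countable_subset)
  then show False using uncountable_closed_interval[of 0 pi] by simp
qed

lemma poly_subst_power: "poly (subst_power p n) x = poly p (x ^ n)"
  by (simp add: subst_power_def poly_pcompose poly_monom)

lemma degree_subst_power: "Polynomial.degree (subst_power p n) = n * Polynomial.degree p"
  by (simp add: subst_power_def degree_pcompose degree_monom_eq)

lemma subst_power_polys_over:
  assumes K: "is_field K" and "p \<in> polys_over K"
  shows "subst_power p n \<in> polys_over K"
  unfolding subst_power_def by (intro polys_over_pcompose[OF assms] polys_over_closed(9)[OF K] is_fieldD(1)[OF K])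

section \<open>The fields generated by cosines\<close>

locale cosine_tower =
  fixes \<alpha> :: real
  assumes irrational: "\<alpha> / pi \<notin> \<rat>" and transcendental_cos: "\<not> algebraic (cos \<alpha>)"
begin

sublocale transcendental_tower "\<lambda>m. complex_of_real (cos (\<alpha> / 2 ^ m))"
proof
  show "complex_of_real (cos (\<alpha> / 2 ^ m)) = 2 * (complex_of_real (cos (\<alpha> / 2 ^ Suc m)))\<^sup>2 - 1" for m
    using arg_cong[OF cos_double_cos[of "\<alpha> / 2 ^ Suc m"], of complex_of_real] by simp
  show "\<not> algebraic (complex_of_real (cos (\<alpha> / 2 ^ 0)))" using transcendental_cos by simp
qed

abbreviation "F \<equiv> cos_tower \<alpha>"
abbreviation "E \<equiv> cos_tower_ext \<alpha>"

lemma cos_field_eq_level: "cos_field \<alpha> m = level m"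
  by (simp add: cos_field_def level_def)

lemma cos_tower_eq: "F = (\<Union>n\<in>{1..}. level n)"
  by (simp add: cos_tower_def cos_field_eq_level)

lemma F_is_field: "is_field F"
  unfolding cos_tower_eq by (rule is_field_chain_Union[OF level_is_field level_mono])

lemma level_subset_F: "level m \<subseteq> F"
  using level_mono[of m "Suc m"] unfolding cos_tower_eq by fastforce

lemma cos_in_F: "complex_of_real (cos (\<alpha> / 2 ^ m)) \<in> F"
  using level_elem level_subset_F by blast

lemma level_real: "level m \<subseteq> \<real>"
  unfolding level_def
  by (rule field_adjoin_least[OF is_field_Reals Rats_subset_field[OF is_field_Reals]]) simp

lemma F_real: "F \<subseteq> \<real>"
  using level_real unfolding cos_tower_eq by blast

lemma finite_root_exponents_F:
  assumes "f \<in> F" "f \<noteq> 0" "f \<noteq> 1" "f \<noteq> -1"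
  shows "finite {n. n \<ge> 1 \<and> (\<exists>x\<in>F. x ^ n = f)}"
proof -
  obtain m where "f \<in> level m" using assms(1) unfolding cos_tower_eq by blast
  from finite_root_exponents[OF this assms(2-4)] show ?thesis
    by (rule rev_finite_subset) (auto simp: cos_tower_eq)
qed

text \<open>
  A root of unity in \<open>F\<close> is \<open>\<plusminus>1\<close>, so it suffices that \<open>f\<close> and \<open>- f\<close> have roots of finitely many
  exponents.
\<close>

lemma rootless_modtor_F: "rootless_modtor_field F"
  unfolding rootless_modtor_field_def rootless_modtor_elem_def
proof (intro ballI impI conjI)
  fix f assume f: "f \<in> F" "f \<noteq> 0 \<and> \<not> root_of_unity f"
  then show "f \<in> F" "\<not> root_of_unity f" by auto
  have ne: "f \<noteq> 1" "f \<noteq> -1" using f not_root_of_unityD by blast+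
  have "- f \<noteq> 1" "- f \<noteq> -1" using ne by (auto simp: minus_equation_iff)
  then have "finite ({n. n \<ge> 1 \<and> (\<exists>x\<in>F. x ^ n = f)} \<union> {n. n \<ge> 1 \<and> (\<exists>x\<in>F. x ^ n = - f)})"
    using finite_root_exponents_F ne f is_fieldD(3)[OF F_is_field] by simp
  moreover have "n \<in> {n. n \<ge> 1 \<and> (\<exists>x\<in>F. x ^ n = f)} \<union> {n. n \<ge> 1 \<and> (\<exists>x\<in>F. x ^ n = - f)}"
    if "n \<ge> 1" "\<zeta> \<in> F" "root_of_unity \<zeta>" "x \<in> F" "x ^ n = \<zeta> * f" for n \<zeta> x
  proof -
    have "\<zeta> = 1 \<or> \<zeta> = -1" using real_root_of_unity F_real that(2,3) by blast
    then have "x ^ n = f \<or> x ^ n = - f" using that(5) by auto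
    then show ?thesis using that(1,4) by blast
  qed
  ultimately show "finite {n. n \<ge> 1 \<and> (\<exists>\<zeta>\<in>F. root_of_unity \<zeta> \<and> (\<exists>x\<in>F. x ^ n = \<zeta> * f))}"
    by (elim finite_subset[rotated]) blast
qed

lemma sin_notin_F: "\<i> * complex_of_real (sin \<alpha>) \<notin> F"
proof
  assume "\<i> * complex_of_real (sin \<alpha>) \<in> F"
  then have "\<i> * complex_of_real (sin \<alpha>) \<in> \<real>" using F_real by blast
  then have "sin \<alpha> = 0" by (simp add: complex_is_Real_iff)
  then have "cis (2 * \<alpha>) = 1" using cos_double_sin[of \<alpha>] sin_double[of \<alpha>] by (simp add: complex_eq_iff)
  then have "root_of_unity (cis \<alpha>)" unfolding root_of_unity_def DeMoivre by (intro exI[of _ 2]) simp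
  then show False using not_root_of_unity_cis[OF irrational] by simp
qed

lemma extension_degree_E: "extension_degree F E 2"
  unfolding cos_tower_ext_def
proof (rule quadratic_extension_degree[OF F_is_field sin_notin_F])
  have "(\<i> * complex_of_real (sin \<alpha>))\<^sup>2 = (complex_of_real (cos (\<alpha> / 2 ^ 0)))\<^sup>2 - 1"
    by (simp add: power_mult_distrib cos_squared_eq flip: of_real_power)
  also have "\<dots> \<in> F"
    by (intro is_fieldD(1,7)[OF F_is_field] is_field_power[OF F_is_field] cos_in_F)
  finally show "(\<i> * complex_of_real (sin \<alpha>))\<^sup>2 \<in> F" .
qed

lemma E_is_field: "is_field E"
  unfolding cos_tower_ext_def by (rule field_adjoin_is_field)

lemma cos_in_E: "complex_of_real (cos (\<alpha> / 2 ^ m)) \<in> E"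
  unfolding cos_tower_ext_def by (rule field_adjoin_base[OF cos_in_F])

text \<open>
  The recursion \<open>sin (t / 2) = sin t / (2 cos (t / 2))\<close>, where the cosine is nonzero because it is transcendental.
\<close>

lemma sin_in_E: "\<i> * complex_of_real (sin (\<alpha> / 2 ^ m)) \<in> E"
proof (induction m)
  case 0
  then show ?case by (simp add: cos_tower_ext_def field_adjoin_elem)
next
  case (Suc m)
  define s c where "s = \<i> * complex_of_real (sin (\<alpha> / 2 ^ Suc m))"
    and "c = complex_of_real (cos (\<alpha> / 2 ^ Suc m))"
  have "c \<noteq> 0" using transcendental[of "Suc m"] algebraic_0 unfolding c_def by metis
  have "c \<in> E" unfolding c_def by (rule cos_in_E)
  have "\<i> * complex_of_real (sin (\<alpha> / 2 ^ m)) = (s * c) + (s * c)"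
    using arg_cong[OF sin_double[of "\<alpha> / 2 ^ Suc m"], of complex_of_real] by (simp add: s_def c_def)
  then have "s = \<i> * complex_of_real (sin (\<alpha> / 2 ^ m)) / (c + c)"
    using \<open>c \<noteq> 0\<close> by (simp add: field_simps)
  also have "\<dots> \<in> E" by (intro is_fieldD(5,8)[OF E_is_field] Suc.IH \<open>c \<in> E\<close>)
  finally show ?case unfolding s_def .
qed

lemma cis_in_E: "cis (\<alpha> / 2 ^ m) \<in> E"
proof -
  have "cis (\<alpha> / 2 ^ m) = complex_of_real (cos (\<alpha> / 2 ^ m)) + \<i> * complex_of_real (sin (\<alpha> / 2 ^ m))"
    by (simp add: complex_eq_iff)
  then show ?thesis using is_fieldD(5)[OF E_is_field cos_in_E sin_in_E] by simp
qed

lemma cis_power_two: "cis (\<alpha> / 2 ^ m) ^ 2 ^ m = cis \<alpha>"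
  by (simp add: DeMoivre)

lemma infinite_root_exponents_E: "infinite {n. n \<ge> 1 \<and> (\<exists>x\<in>E. x ^ n = cis \<alpha>)}"
proof
  assume "finite {n. n \<ge> 1 \<and> (\<exists>x\<in>E. x ^ n = cis \<alpha>)}"
  moreover have "range (\<lambda>m. 2 ^ m) \<subseteq> {n. n \<ge> 1 \<and> (\<exists>x\<in>E. x ^ n = cis \<alpha>)}"
    using cis_in_E cis_power_two by auto
  ultimately have "finite (range (\<lambda>m. 2 ^ m :: nat))" by (rule finite_subset[rotated])
  moreover have "inj (\<lambda>m. 2 ^ m :: nat)" by (simp add: inj_on_def)
  ultimately show False using range_inj_infinite by blast
qed

lemma cis_in_E_0: "cis \<alpha> \<in> E"
  using cis_in_E[of 0] by simp

lemma not_rootless_E: "\<not> rootless_field E"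
  using infinite_root_exponents_E cis_in_E_0 not_root_of_unity_cis[OF irrational] cis_neq_zero
  unfolding rootless_field_def rootless_elem_def by blast

lemma not_rootless_modtor_E: "\<not> rootless_modtor_field E"
proof
  assume "rootless_modtor_field E"
  then have "finite {n. n \<ge> 1 \<and> (\<exists>\<zeta>\<in>E. root_of_unity \<zeta> \<and> (\<exists>x\<in>E. x ^ n = \<zeta> * cis \<alpha>))}"
    using cis_in_E_0 not_root_of_unity_cis[OF irrational]
    unfolding rootless_modtor_field_def rootless_modtor_elem_def by auto
  moreover have "root_of_unity (1::complex)" unfolding root_of_unity_def by auto
  then have "{n. n \<ge> 1 \<and> (\<exists>x\<in>E. x ^ n = cis \<alpha>)} \<subseteq>
      {n. n \<ge> 1 \<and> (\<exists>\<zeta>\<in>E. root_of_unity \<zeta> \<and> (\<exists>x\<in>E. x ^ n = \<zeta> * cis \<alpha>))}"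
    using is_fieldD(1)[OF E_is_field] by force
  ultimately show False using infinite_root_exponents_E finite_subset by blast
qed

lemma rootless_F: "rootless_field F"
  unfolding rootless_field_def rootless_elem_def
  using finite_root_exponents_F not_root_of_unityD by auto

text \<open>
  The minimal polynomial over \<open>F\<close> of \<open>cis (\<alpha> / 2\<^sup>m)\<close>; its other root is the complex conjugate.
\<close>

definition conj_poly :: "nat \<Rightarrow> complex poly" where
  "conj_poly m = [:1, - 2 * complex_of_real (cos (\<alpha> / 2 ^ m)), 1:]"

lemma conj_poly_over: "conj_poly m \<in> polys_over F"
proof -
  have "- (complex_of_real (cos (\<alpha> / 2 ^ m)) + complex_of_real (cos (\<alpha> / 2 ^ m))) \<in> F"
    by (intro is_fieldD(3,5)[OF F_is_field] cos_in_F)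
  then have "- 2 * complex_of_real (cos (\<alpha> / 2 ^ m)) \<in> F" by simp
  then show ?thesis unfolding conj_poly_def
    by (intro polys_over_closed(1,8)[OF F_is_field] is_fieldD(1)[OF F_is_field])
qed

lemma poly_conj_poly:
  "poly (conj_poly m) x = (x - cis (\<alpha> / 2 ^ m)) * (x - cis (- (\<alpha> / 2 ^ m)))"
proof -
  define t where "t = \<alpha> / 2 ^ m"
  have "cis t * cis (- t) = 1" "cis t + cis (- t) = 2 * complex_of_real (cos t)"
    by (simp_all add: cis_mult complex_eq_iff)
  moreover have "(x - cis t) * (x - cis (- t)) = cis t * cis (- t) - (cis t + cis (- t)) * x + x\<^sup>2"
    by (simp add: algebra_simps power2_eq_square)
  ultimately show ?thesis
    by (simp add: conj_poly_def t_def[symmetric] algebra_simps power2_eq_square)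
qed

text \<open>
  For a factor \<open>q\<close>, the degree of \<open>q(x\<^sup>N)\<close> grows with \<open>N\<close> while its root \<open>w\<close> keeps bounded degree over
  \<open>F\<close>: dividing the angle of \<open>w\<^sup>n\<close> by powers of \<open>2\<close> costs no degree over \<open>F\<close>.
\<close>

lemma conj_poly_not_good: "\<not> good_heredity_poly F (conj_poly 0)"
proof
  assume "good_heredity_poly F (conj_poly 0)"
  then obtain n c qs where n: "n \<ge> 1" and c: "c \<noteq> 0"
    and qs: "\<forall>q\<in>set qs. hereditarily_irreducible F q"
    and fact: "subst_power (conj_poly 0) n = Polynomial.smult c (prod_list qs)"
    unfolding good_heredity_poly_def by blast
  define z where "z = cis (\<alpha> / real n)"
  have "poly (subst_power (conj_poly 0) n) z = 0"
    using n by (simp add: poly_subst_power poly_conj_poly z_def DeMoivre)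
  then have "poly (prod_list qs) z = 0" unfolding fact using c by simp
  then obtain q where q: "q \<in> set qs" "poly q z = 0"
    by (induction qs) auto
  \<comment> \<open>Any power of two above \<open>2 n\<close> would do.\<close>
  define N where "N = (2::nat) ^ (2 * n)"
  have N: "2 * n < N" unfolding N_def by simp
  have irr: "irreducible_over F (subst_power q N)"
    using qs q(1) N unfolding hereditarily_irreducible_def by auto
  define w where "w = cis (\<alpha> / (real n * 2 ^ (2 * n)))"
  have "w ^ N = z" using n by (simp add: w_def z_def N_def DeMoivre)
  then have "poly (subst_power q N) w = 0" using q(2) by (simp add: poly_subst_power)
  moreover have "w ^ n = cis (\<alpha> / 2 ^ (2 * n))" using n by (simp add: w_def DeMoivre)
  then have "poly (subst_power (conj_poly (2 * n)) n) w = 0"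
    by (simp add: poly_subst_power poly_conj_poly)
  moreover have "subst_power (conj_poly (2 * n)) n \<in> polys_over F"
    by (rule subst_power_polys_over[OF F_is_field conj_poly_over])
  moreover have deg: "Polynomial.degree (subst_power (conj_poly (2 * n)) n) = 2 * n"
    by (simp add: degree_subst_power conj_poly_def)
  moreover from deg n have "subst_power (conj_poly (2 * n)) n \<noteq> 0" by auto
  ultimately have "N * Polynomial.degree q \<le> 2 * n"
    using irreducible_over_degree_le[OF F_is_field irr] by (metis degree_subst_power)
  then have "Polynomial.degree q = 0" using N by (cases "Polynomial.degree q") auto
  then have "q = 0" using q(2) by (auto elim: degree_eq_zeroE)
  then have "subst_power q N = 0" by (simp add: subst_power_def)
  then show False using irr unfolding irreducible_over_def ring_irreducible_def
    by (simp add: poly_ring_over_def ring_of_type_algebra_def)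
qed

lemma not_good_heredity_F: "\<not> good_heredity_field F"
proof
  assume "good_heredity_field F"
  moreover have "z \<noteq> 0 \<and> \<not> root_of_unity z" if "poly (conj_poly 0) z = 0" for z
  proof -
    have "z = cis \<alpha> \<or> z = cis (- \<alpha>)" using that by (auto simp: poly_conj_poly)
    moreover have "(- \<alpha>) / pi \<notin> \<rat>" using irrational by simp
    ultimately show ?thesis using not_root_of_unity_cis irrational by auto
  qed
  ultimately have "good_heredity_poly F (conj_poly 0)"
    unfolding good_heredity_field_def using conj_poly_over by auto
  then show False using conj_poly_not_good by blast
qed

end

section \<open>Rootlessness and heredity in the cosine tower\<close>

theorem mainTheorem10:
  shows "(\<forall>\<alpha>::real. \<alpha> / pi \<notin> \<rat> \<and> \<not> algebraic (cos \<alpha>) \<longrightarrow>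
            (\<forall>n\<ge>1. cos_field \<alpha> n \<subseteq> \<real> \<and> cos_field \<alpha> n \<subseteq> cos_field \<alpha> (Suc n))
          \<and> extension_degree (cos_tower \<alpha>) (cos_tower_ext \<alpha>) 2
          \<and> (rootless_field (cos_tower \<alpha>) \<and> rootless_modtor_field (cos_tower \<alpha>))
          \<and> (\<not> rootless_field (cos_tower_ext \<alpha>) \<and> \<not> rootless_modtor_field (cos_tower_ext \<alpha>))
          \<and> \<not> good_heredity_field (cos_tower \<alpha>))
       \<and> (\<exists>K L :: complex set. finite_extension K L \<and> rootless_field K \<and> \<not> rootless_field L)
       \<and> (\<exists>K L :: complex set. finite_extension K L
             \<and> rootless_modtor_field K \<and> \<not> rootless_modtor_field L)"
proof -
  have main: "(\<forall>n\<ge>1. cos_field \<alpha> n \<subseteq> \<real> \<and> cos_field \<alpha> n \<subseteq> cos_field \<alpha> (Suc n))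
          \<and> extension_degree (cos_tower \<alpha>) (cos_tower_ext \<alpha>) 2
          \<and> (rootless_field (cos_tower \<alpha>) \<and> rootless_modtor_field (cos_tower \<alpha>))
          \<and> (\<not> rootless_field (cos_tower_ext \<alpha>) \<and> \<not> rootless_modtor_field (cos_tower_ext \<alpha>))
          \<and> \<not> good_heredity_field (cos_tower \<alpha>)"
    if "\<alpha> / pi \<notin> \<rat> \<and> \<not> algebraic (cos \<alpha>)" for \<alpha> :: real
  proof -
    interpret cosine_tower \<alpha> by unfold_locales (use that in auto)
    show ?thesis
      using level_real level_Suc extension_degree_E rootless_F rootless_modtor_F
        not_rootless_E not_rootless_modtor_E not_good_heredity_F
      unfolding cos_field_eq_level by blast
  qed
  obtain \<alpha> :: real where "\<alpha> / pi \<notin> \<rat> \<and> \<not> algebraic (cos \<alpha>)"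
    using exists_transcendental_cosine by blast
  note ex = main[OF this]
  then have "finite_extension (cos_tower \<alpha>) (cos_tower_ext \<alpha>)"
    unfolding finite_extension_def by blast
  with main ex show ?thesis by blast
qed

end
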